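(* Let $\Gamma$ be a connected finite simple graph with at least three vertices and let $\ell\ge1$ be an integer. Then there is an eigenvalue $\lambda^{[\ell]}$ of $\Delta^{[\ell]}$ with $|1-\lambda^{[\ell]}|\le 2^{-\ell}$. If $\ell$ is even, the largest eigenvalue $\lambda^{[\ell]}_N$ of $\Delta^{[\ell]}$ satisfies $1-2^{-\ell}\le\lambda^{[\ell]}_N\le1$, and each of these two bounds is attained by some connected graph with at least three vertices.
   Context: The normalized Laplacian of a finite simple graph without isolated vertices acts on $f:V\to\mathbb R$ by $\Delta f(v)=f(v)-\frac{1}{\deg v}\sum_{w\sim v}f(w)$. For an integer $\ell\ge1$, the Laplacian of the neighborhood graph of order $\ell$ is the operator $\Delta^{[\ell]}:=I-(I-\Delta)^{\ell}$ on functions $V\to\mathbb R$, with eigenvalues $\lambda^{[\ell]}_1\le\dots\le\lambda^{[\ell]}_N$. *)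

theory Defs
  imports Main "HOL-Library.Transitive_Closure_Table" Complex_Main
begin

definition simple_graph :: "'a set \<Rightarrow> ('a \<Rightarrow> 'a \<Rightarrow> bool) \<Rightarrow> bool" where
  "simple_graph V E \<longleftrightarrow> finite V \<and> (\<forall>x y. E x y \<longrightarrow> x \<in> V \<and> y \<in> V)
     \<and> (\<forall>x y. E x y \<longrightarrow> E y x) \<and> (\<forall>x. \<not> E x x)"

definition connected_graph :: "'a set \<Rightarrow> ('a \<Rightarrow> 'a \<Rightarrow> bool) \<Rightarrow> bool" where
  "connected_graph V E \<longleftrightarrow> simple_graph V E \<and> V \<noteq> {} \<and> (\<forall>x\<in>V. \<forall>y\<in>V. E\<^sup>*\<^sup>* x y)"

definition deg :: "'a set \<Rightarrow> ('a \<Rightarrow> 'a \<Rightarrow> bool) \<Rightarrow> 'a \<Rightarrow> nat" where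
  "deg V E v = card {w\<in>V. E v w}"

definition nlap :: "'a set \<Rightarrow> ('a \<Rightarrow> 'a \<Rightarrow> bool) \<Rightarrow> ('a \<Rightarrow> real) \<Rightarrow> ('a \<Rightarrow> real)" where
  "nlap V E f = (\<lambda>v. f v - (\<Sum>w\<in>{w\<in>V. E v w}. f w) / real (deg V E v))"

text \<open>Laplacian of the neighbourhood graph of order l: I - (I - Delta)^l.\<close>
definition nbhd_lap :: "'a set \<Rightarrow> ('a \<Rightarrow> 'a \<Rightarrow> bool) \<Rightarrow> nat \<Rightarrow> ('a \<Rightarrow> real) \<Rightarrow> ('a \<Rightarrow> real)" where
  "nbhd_lap V E l f = (\<lambda>v. f v - (((\<lambda>g u. g u - nlap V E g u) ^^ l) f) v)"

definition is_nbhd_eigenvalue :: "'a set \<Rightarrow> ('a \<Rightarrow> 'a \<Rightarrow> bool) \<Rightarrow> nat \<Rightarrow> real \<Rightarrow> bool" where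
  "is_nbhd_eigenvalue V E l \<mu> \<longleftrightarrow>
     (\<exists>f. (\<forall>v. v \<notin> V \<longrightarrow> f v = 0) \<and> (\<exists>v\<in>V. f v \<noteq> 0) \<and>
          (\<forall>v\<in>V. nbhd_lap V E l f v = \<mu> * f v))"

definition largest_nbhd_eigenvalue :: "'a set \<Rightarrow> ('a \<Rightarrow> 'a \<Rightarrow> bool) \<Rightarrow> nat \<Rightarrow> real" where
  "largest_nbhd_eigenvalue V E l = Max {\<mu>. is_nbhd_eigenvalue V E l \<mu>}"

end

theory Submission
  imports Defs "HOL-Analysis.Function_Topology"
begin

text \<open>
  Let \<open>P = I - \<Delta>\<close>, which is self-adjoint for the degree-weighted inner product, so that it suffices to
  find an eigenvalue of \<open>P\<close> in \<open>[-1/2, 1/2]\<close>. A minimizer of the Rayleigh quotient of \<open>P\<^sup>2\<close> yields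
  one as soon as some \<open>f \<noteq> 0\<close> has \<open>\<parallel>P f\<parallel>\<^sup>2 \<le> \<parallel>f\<parallel>\<^sup>2 / 4\<close>. If there is no such \<open>f\<close>, then testing with
  \<open>a 1\<^sub>u - b 1\<^sub>v\<close> constrains the degrees near \<open>u\<close> and \<open>v\<close>. When all degrees are at least two, this
  forces almost all neighbours of some vertex \<open>u\<close> to have degree at least five, which contradicts the
  test function \<open>1\<^sub>u\<close>. When there is a leaf, some vertex at distance two from it has many
  leafless neighbours of degree three, and two of these again give a contradiction.
\<close>

section \<open>The averaging operator and the degree-weighted inner product\<close>

locale big_graph =
  fixes V :: "'a set" and E :: "'a \<Rightarrow> 'a \<Rightarrow> bool"
  assumes conn: "connected_graph V E" and card_V: "3 \<le> card V"
begin

definition nb :: "'a \<Rightarrow> 'a set" where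
  "nb v = {w \<in> V. E v w}"

abbreviation d :: "'a \<Rightarrow> real" where
  "d v \<equiv> real (card (nb v))"

lemma finite_V [simp]: "finite V"
  using conn by (simp add: connected_graph_def simple_graph_def)

lemma finite_nb [simp]: "finite (nb v)"
  by (simp add: nb_def)

lemma nb_sym: "v \<in> nb w \<longleftrightarrow> w \<in> nb v"
  using conn unfolding connected_graph_def simple_graph_def nb_def by blast

lemma nb_subset: "nb v \<subseteq> V"
  by (auto simp: nb_def)

lemma nb_in_V: "w \<in> nb v \<Longrightarrow> w \<in> V \<and> v \<in> V"
  using nb_sym nb_subset by blast

text \<open>Connectedness in its usable form: a walk that starts in \<open>C\<close> can never leave
  it.\<close>

lemma closed_subset_eq:
  assumes "C \<subseteq> V" "C \<noteq> {}" "\<And>v w. v \<in> C \<Longrightarrow> w \<in> nb v \<Longrightarrow> w \<in> C"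
  shows "C = V"
proof -
  obtain c where c: "c \<in> C" using assms by blast
  have "y \<in> C" if "y \<in> V" for y
  proof -
    have "E\<^sup>*\<^sup>* c y" using conn c assms(1) that unfolding connected_graph_def by blast
    then show ?thesis
    proof (induction rule: rtranclp_induct)
      case base
      then show ?case by (fact c)
    next
      case (step y z)
      then have "z \<in> nb y"
        using conn unfolding connected_graph_def simple_graph_def nb_def by blast
      then show ?case using assms(3) step by blast
    qed
  qed
  then show ?thesis using assms(1) by blast
qed

lemma deg_pos: "v \<in> V \<Longrightarrow> 1 \<le> card (nb v)"
proof (rule ccontr)
  assume v: "v \<in> V" "\<not> 1 \<le> card (nb v)"
  then have "nb v = {}" by (simp add: not_le)
  then have "{v} = V" using closed_subset_eq[of "{v}"] v by auto
  then have "card V = 1" by (metis card_1_singleton_iff One_nat_def)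
  then show False using card_V by simp
qed

lemma d_pos: "v \<in> V \<Longrightarrow> 0 < d v"
  using deg_pos[of v] by simp

definition P :: "('a \<Rightarrow> real) \<Rightarrow> 'a \<Rightarrow> real" where
  "P f = (\<lambda>v. (\<Sum>w\<in>nb v. f w) / d v)"

definition ip :: "('a \<Rightarrow> real) \<Rightarrow> ('a \<Rightarrow> real) \<Rightarrow> real" where
  "ip f g = (\<Sum>v\<in>V. d v * (f v * g v))"

text \<open>This is \<open>ip (P g) (P g)\<close> for \<open>g\<close> the indicator of
  \<open>u\<close>.\<close>

definition S :: "'a \<Rightarrow> real" where
  "S u = (\<Sum>w\<in>nb u. 1 / d w)"

lemma sum_nb: "(\<Sum>w\<in>nb v. f w) = (\<Sum>w\<in>V. if w \<in> nb v then f w else 0)"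
  for f :: "'a \<Rightarrow> real"
  by (simp add: sum.If_cases Int_absorb1 nb_subset)

lemma ip_P_P: "ip (P f) (P f) = (\<Sum>w\<in>V. (\<Sum>x\<in>nb w. f x)\<^sup>2 / d w)"
  unfolding ip_def
proof (rule sum.cong)
  fix v assume "v \<in> V"
  then show "d v * (P f v * P f v) = (\<Sum>x\<in>nb v. f x)\<^sup>2 / d v"
    using d_pos[of v] by (simp add: P_def power2_eq_square)
qed simp

end

section \<open>Degree constraints from test functions\<close>

text \<open>The assumption denies what \<open>small_eigenfunction\<close> needs; the locale collects
  its consequences up to \<open>inconsistent\<close>.\<close>

locale gapped_graph = big_graph +
  assumes gap: "v \<in> V \<Longrightarrow> f v \<noteq> 0 \<Longrightarrow> ip f f / 4 < ip (P f) (P f)"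
begin

text \<open>The gap assumption for \<open>a\<close> times the indicator of \<open>u\<close> minus
  \<open>b\<close> times that of \<open>v\<close>. The two contributions overlap exactly on the
  common neighbours, which gives the cross term.\<close>

lemma pair_ineq_general:
  assumes "u \<in> V" "v \<in> V" "u \<noteq> v" "a \<noteq> 0"
  shows "(a\<^sup>2 * d u + b\<^sup>2 * d v) / 4
    < a\<^sup>2 * S u + b\<^sup>2 * S v - 2 * a * b * (\<Sum>w\<in>nb u \<inter> nb v. 1 / d w)"
proof -
  define f where "f x = (if x = u then a else 0) - (if x = v then b else 0)" for x
  have "f u \<noteq> 0" using assms by (simp add: f_def)
  then have *: "ip f f / 4 < ip (P f) (P f)" using gap assms by blast
  have "d x * (f x * f x)
      = (if x = u then a\<^sup>2 * d u else 0) + (if x = v then b\<^sup>2 * d v else 0)" for x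
    using assms by (auto simp: f_def power2_eq_square)
  then have ff: "ip f f = a\<^sup>2 * d u + b\<^sup>2 * d v"
    using assms by (simp add: ip_def sum.distrib)
  have inner: "(\<Sum>x\<in>nb w. f x) = (if w \<in> nb u then a else 0) - (if w \<in> nb v then b else 0)" for w
    by (simp add: f_def sum_subtractf nb_sym[of w])
  have "(\<Sum>x\<in>nb w. f x)\<^sup>2 / d w = a\<^sup>2 * (if w \<in> nb u then 1 / d w else 0)
      + b\<^sup>2 * (if w \<in> nb v then 1 / d w else 0)
      - 2 * a * b * (if w \<in> nb u \<inter> nb v then 1 / d w else 0)" for w
    unfolding inner by (auto simp: power2_eq_square algebra_simps diff_divide_distrib add_divide_distrib)
  then have "ip (P f) (P f) = a\<^sup>2 * S u + b\<^sup>2 * S v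
      - 2 * a * b * (\<Sum>w\<in>V. if w \<in> nb u \<inter> nb v then 1 / d w else 0)"
    by (simp only: ip_P_P S_def sum_nb sum.distrib sum_subtractf sum_distrib_left)
  moreover have "nb u \<inter> nb v \<subseteq> V" using nb_subset by blast
  then have "(\<Sum>w\<in>V. if w \<in> nb u \<inter> nb v then 1 / d w else 0) = (\<Sum>w\<in>nb u \<inter> nb v. 1 / d w)"
    by (subst sum.inter_restrict[symmetric]) (auto simp: Int_absorb1)
  ultimately show ?thesis using * ff by simp
qed

lemma single_ineq:
  assumes "u \<in> V"
  shows "d u / 4 < S u"
proof -
  have "card {u} < card V" using card_V by simp
  then have "\<not> V \<subseteq> {u}" by (metis card_mono finite.emptyI finite_insert not_less)
  then obtain v where "v \<in> V" "u \<noteq> v" by blast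
  \<comment> \<open>With \<open>b = 0\<close> the test function is the indicator of
    \<open>u\<close>, and any second vertex \<open>v\<close> will do.\<close>
  then show ?thesis using pair_ineq_general[of u v 1 0] assms by simp
qed

text \<open>Of all common neighbours only \<open>c\<close> is kept; for nonnegative
  \<open>b\<close>, dropping the others only enlarges the right-hand side.\<close>

lemma weighted_pair_ineq:
  assumes "c \<in> nb u" "c \<in> nb v" "u \<noteq> v" "0 \<le> b"
  shows "(d u + b\<^sup>2 * d v) / 4 < S u + b\<^sup>2 * S v - 2 * b / d c"
proof -
  have "1 / d c \<le> (\<Sum>w\<in>nb u \<inter> nb v. 1 / d w)"
    using assms by (intro member_le_sum) auto
  then have "2 * b * (1 / d c) \<le> 2 * b * (\<Sum>w\<in>nb u \<inter> nb v. 1 / d w)"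
    using assms by (intro mult_left_mono) auto
  then show ?thesis using pair_ineq_general[of u v 1 b] assms nb_in_V[of c] by force
qed

lemma pair_ineq:
  assumes "c \<in> nb u" "c \<in> nb v" "u \<noteq> v"
  shows "(d u + d v) / 4 < S u + S v - 2 / d c"
  using weighted_pair_ineq[OF assms, of 1] by simp

section \<open>Bounds on \<open>S\<close> from the degrees of the neighbours\<close>

lemma nb_deg_1: "card (nb x) = 1 \<Longrightarrow> u \<in> nb x \<Longrightarrow> nb x = {u}"
  by (metis card_1_singletonE singletonD)

lemma nb_deg_2:
  assumes "card (nb x) = 2" "u \<in> nb x"
  obtains v where "nb x = {u, v}" "u \<noteq> v"
  using assms unfolding card_2_iff by (metis doubleton_eq_iff insertE singletonD)

lemma nb_deg_3:
  assumes "card (nb x) = 3" "u \<in> nb x"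
  obtains v w where "nb x = {u, v, w}" "u \<noteq> v" "u \<noteq> w" "v \<noteq> w"
proof -
  have "card (nb x - {u}) = 2" using assms by simp
  then obtain v w where "nb x - {u} = {v, w}" "v \<noteq> w" by (auto simp: card_2_iff)
  then show ?thesis using that[of v w] assms by blast
qed

lemma inverse_d_le: "n \<le> card (nb w) \<Longrightarrow> 0 < n \<Longrightarrow> 1 / d w \<le> 1 / real n"
  by (simp add: frac_le)

text \<open>The neighbour \<open>k\<close> is split off: it is either the one exception of low
  degree, or a common neighbour whose term \<open>1 / d k\<close> is to cancel against
  \<open>- 2 / d c\<close> in \<open>pair_ineq\<close>.\<close>

lemma S_le:
  assumes "k \<in> nb u" "0 < m" "m \<le> card (nb k)" "0 < n"
    and "\<And>w. w \<in> nb u \<Longrightarrow> w \<noteq> k \<Longrightarrow> n \<le> card (nb w)"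
  shows "S u \<le> 1 / real m + (d u - 1) / real n"
proof -
  have "S u = 1 / d k + (\<Sum>w\<in>nb u - {k}. 1 / d w)"
    unfolding S_def using assms by (simp add: sum.remove)
  also have "1 / d k \<le> 1 / real m" using assms inverse_d_le by blast
  also have "(\<Sum>w\<in>nb u - {k}. 1 / d w) \<le> (\<Sum>w\<in>nb u - {k}. 1 / real n)"
    using assms inverse_d_le by (intro sum_mono) auto
  also have "\<dots> = (d u - 1) / real n"
    using assms deg_pos[of u] nb_in_V[of k u] by (simp add: of_nat_diff)
  finally show ?thesis by simp
qed

lemma S_le_at_most_one:
  assumes "u \<in> V" "0 < m" "m \<le> n" "\<And>w. w \<in> nb u \<Longrightarrow> m \<le> card (nb w)"
    and "\<And>w w'. w \<in> nb u \<Longrightarrow> w' \<in> nb u \<Longrightarrow> card (nb w) < n \<Longrightarrow> card (nb w') < n \<Longrightarrow> w = w'"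
  shows "S u \<le> 1 / real m + (d u - 1) / real n"
proof -
  have "nb u \<noteq> {}" using deg_pos[OF assms(1)] by auto
  then obtain k where "k \<in> nb u" "\<And>w. w \<in> nb u \<Longrightarrow> w \<noteq> k \<Longrightarrow> n \<le> card (nb w)"
    using assms(5) by (metis ex_in_conv not_le)
  then show ?thesis using S_le[of k u m n] assms by auto
qed

section \<open>Neighbours of degree two, and graphs without leaves\<close>

definition leafless :: "'a \<Rightarrow> bool" where
  "leafless v \<longleftrightarrow> (\<forall>w\<in>nb v. 2 \<le> card (nb w))"

text \<open>Two such vertices each have \<open>S\<close> at most \<open>1 / d c + 1 / 2\<close>; in
  \<open>pair_ineq\<close> at \<open>c\<close> the terms in \<open>d c\<close> cancel and
  \<open>1 < 1\<close> remains.\<close>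

lemma deg_2_nb_unique:
  assumes "p \<in> nb c" "p' \<in> nb c" "card (nb p) = 2" "card (nb p') = 2" "leafless p" "leafless p'"
  shows "p = p'"
proof (rule ccontr)
  assume ne: "p \<noteq> p'"
  have S2: "S q \<le> 1 / d c + 1 / 2" if q: "q \<in> nb c" "card (nb q) = 2" "leafless q" for q
  proof -
    have "c \<in> nb q" using q nb_sym by blast
    moreover have "0 < card (nb c)" using deg_pos[of c] nb_in_V q by fastforce
    ultimately show ?thesis using S_le[of c q "card (nb c)" 2] q by (auto simp: leafless_def)
  qed
  show False
    using pair_ineq[of c p p'] ne assms S2[of p] S2[of p'] nb_sym[of c] by simp
qed

text \<open>By \<open>pair_ineq\<close>, at most one neighbour of \<open>u\<close> has degree below
  five; then \<open>S u\<close> is too small for \<open>single_ineq\<close>.\<close>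

lemma min_deg_3_False:
  assumes ge3: "\<And>v. v \<in> V \<Longrightarrow> 3 \<le> card (nb v)"
  shows False
proof -
  obtain u where u: "u \<in> V" using card_V by fastforce
  have ge3': "3 \<le> card (nb w)" if "w \<in> nb v" for v w
    using ge3 that nb_in_V by blast
  have bound: "S a \<le> 1 / d c + (d a - 1) / 3" if "c \<in> nb a" for a c
    using S_le[of c a "card (nb c)" 3] that ge3' ge3'[OF that] by force
  have "w = w'" if "w \<in> nb u" "w' \<in> nb u" "card (nb w) < 5" "card (nb w') < 5" for w w'
  proof (rule ccontr)
    assume "w \<noteq> w'"
    moreover have c: "u \<in> nb w" "u \<in> nb w'" using that nb_sym by blast+
    ultimately have "(d w + d w') / 4 < S w + S w' - 2 / d u" by (intro pair_ineq)
    moreover have "d w \<le> 4" "d w' \<le> 4" using that by auto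
    \<comment> \<open>The terms in \<open>d u\<close> cancel and \<open>8 < d w + d w'\<close>
      remains.\<close>
    ultimately show False using bound[OF c(1)] bound[OF c(2)] by (simp add: field_simps)
  qed
  then have "S u \<le> 1 / 3 + (d u - 1) / 5"
    using S_le_at_most_one[of u 3 5] u ge3' by auto
  moreover have "3 \<le> d u" using ge3[OF u] by simp
  \<comment> \<open>The two bounds on \<open>S u\<close> give \<open>d u < 8 / 3\<close>.\<close>
  ultimately show False using single_ineq[OF u] by (simp add: field_simps)
qed

text \<open>By \<open>min_deg_3_False\<close> there is a vertex of degree two. It forces a neighbour
  \<open>u\<close> of degree at least seven, all of whose other neighbours have degree at least
  five, and \<open>single_ineq\<close> fails at \<open>u\<close>.\<close>

lemma min_deg_2_False:
  assumes ge2: "\<And>v. v \<in> V \<Longrightarrow> 2 \<le> card (nb v)"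
  shows False
proof -
  have ge2': "2 \<le> card (nb w)" if "w \<in> nb v" for v w
    using ge2 that nb_in_V by blast
  have uniq: "p = p'" if "p \<in> nb c" "p' \<in> nb c" "card (nb p) = 2" "card (nb p') = 2" for c p p'
    using deg_2_nb_unique[OF that] ge2' by (auto simp: leafless_def)
  have S_bound: "S u \<le> 1 / 2 + (d u - 1) / 3" if "u \<in> V" for u
  proof -
    have "w = w'" if "w \<in> nb u" "w' \<in> nb u" "card (nb w) < 3" "card (nb w') < 3" for w w'
      using uniq[OF that(1,2)] that ge2'[OF that(1)] ge2'[OF that(2)] by linarith
    then show ?thesis using S_le_at_most_one[of u 2 3] that ge2' by auto
  qed
  \<comment> \<open>At \<open>w\<close>, \<open>pair_ineq\<close> yields
    \<open>8 < d u + d v\<close> and \<open>single_ineq\<close> yields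
    \<open>1 / 2 < 1 / d u + 1 / d v\<close>; together they leave only \<open>d v = 2\<close> with
    \<open>d u\<close> at least seven.\<close>
  have main: "card (nb v) = 2 \<and> 7 \<le> card (nb u)"
    if w: "nb w = {u, v}" "u \<noteq> v" "card (nb v) \<le> card (nb u)" for u v w
  proof -
    have uv: "w \<in> nb u" "w \<in> nb v" "u \<in> V" "v \<in> V" "w \<in> V"
      using w nb_sym[of w] nb_in_V[of _ w] by auto
    have cw: "card (nb w) = 2" using w by simp
    have "(d u + d v) / 4 < S u + S v - 2 / d w"
      using pair_ineq uv w by blast
    then have "8 < d u + d v" using S_bound[of u] S_bound[of v] uv cw by (simp add: field_simps)
    then have nine: "9 \<le> card (nb u) + card (nb v)" by linarith
    have sing: "1 / 2 < 1 / d u + 1 / d v" using single_ineq[of w] uv cw w by (simp add: S_def)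
    have "5 \<le> card (nb u)" using nine w by linarith
    then have du: "1 / d u \<le> 1 / 5" using inverse_d_le[of 5 u] by simp
    have "card (nb v) \<le> 3"
    proof (rule ccontr)
      assume "\<not> ?thesis"
      then have "1 / d v \<le> 1 / 4" using inverse_d_le[of 4 v] by simp
      then show False using sing du by linarith
    qed
    moreover have "card (nb v) \<noteq> 3"
    proof
      assume "card (nb v) = 3"
      \<comment> \<open>Borderline case: \<open>1 / 3 + 1 / 6\<close> is exactly
        \<open>1 / 2\<close>.\<close>
      moreover from this have "1 / d u \<le> 1 / 6" using inverse_d_le[of 6 u] nine by simp
      ultimately show False using sing by simp
    qed
    ultimately have "card (nb v) = 2" using ge2[OF uv(4)] by linarith
    then show ?thesis using nine by linarith
  qed
  have "\<not> (\<forall>v\<in>V. 3 \<le> card (nb v))" using min_deg_3_False by blast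
  then obtain w where w: "w \<in> V" "card (nb w) = 2" using ge2 by fastforce
  then obtain u v where uv: "nb w = {u, v}" "u \<noteq> v" "card (nb v) \<le> card (nb u)"
    by (metis card_2_iff insert_commute nle_le)
  then have u7: "7 \<le> card (nb u)" and v2: "card (nb v) = 2" using main by blast+
  have wu: "u \<in> nb w" "w \<in> nb u" "u \<in> V" using uv nb_sym nb_in_V by blast+
  have ge5: "5 \<le> card (nb a)" if a: "a \<in> nb u" "a \<noteq> w" for a
  proof (rule ccontr)
    assume "\<not> ?thesis"
    then have a4: "card (nb a) \<le> 4" by simp
    have "card (nb a) \<noteq> 2" using uniq[of a u w] a w wu by blast
    then have a3: "3 \<le> card (nb a)" using ge2'[OF a(1)] by simp
    \<comment> \<open>By \<open>main\<close>, the neighbours of a vertex of degree two have degree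
      two and at least seven, but \<open>a\<close> has degree three or four.\<close>
    have "3 \<le> card (nb b)" if b: "b \<in> nb a" for b
    proof (rule ccontr)
      assume "\<not> ?thesis"
      then have "card (nb b) = 2" using ge2'[OF b] by simp
      moreover have "a \<in> nb b" using b nb_sym by blast
      ultimately obtain a' where "nb b = {a, a'}" "a \<noteq> a'" using nb_deg_2 by blast
      moreover from this have "nb b = {a', a}" by blast
      ultimately show False using main[of b a a'] main[of b a' a] a3 a4
        by (cases "card (nb a') \<le> card (nb a)") auto
    qed
    moreover have ua: "u \<in> nb a" using a nb_sym by blast
    ultimately have "S a \<le> 1 / d u + (d a - 1) / 3"
      using S_le[of u a "card (nb u)" 3] u7 by auto
    moreover have "S w = 1 / d u + 1 / 2" using uv v2 by (simp add: S_def)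
    moreover have "(d w + d a) / 4 < S w + S a - 2 / d u" using pair_ineq[of u w a] a ua wu by blast
    moreover have "d w = 2" "d a \<le> 4" using w a4 by auto
    \<comment> \<open>The terms in \<open>d u\<close> cancel and \<open>4 < d a\<close>
      remains.\<close>
    ultimately show False by (simp add: field_simps)
  qed
  have "S u \<le> 1 / 2 + (d u - 1) / 5" using S_le[of w u 2 5] wu w ge5 by auto
  moreover have "7 \<le> d u" using u7 by simp
  ultimately show False using single_ineq[of u] wu by (simp add: field_simps)
qed

section \<open>Graphs with a leaf\<close>

lemma S_leaf: "card (nb x) = 1 \<Longrightarrow> u \<in> nb x \<Longrightarrow> S x = 1 / d u"
  using nb_deg_1[of x u] by (simp add: S_def)

text \<open>\<open>P\<close> annihilates the difference of the indicators of two leaves at the same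
  vertex.\<close>

lemma leaf_unique:
  assumes "x \<in> nb u" "y \<in> nb u" "card (nb x) = 1" "card (nb y) = 1"
  shows "x = y"
  using pair_ineq[of u x y] assms S_leaf[of x u] S_leaf[of y u] nb_sym[of u] by force

text \<open>If \<open>u\<close> had degree one, the edge would be a component with only two
  vertices; degree four or more violates \<open>single_ineq\<close> at the leaf.\<close>

lemma leaf_nb_deg:
  assumes "card (nb x) = 1" "u \<in> nb x"
  shows "card (nb u) = 2 \<or> card (nb u) = 3"
proof -
  have x: "x \<in> V" "u \<in> V" "x \<in> nb u" "nb x = {u}"
    using assms nb_in_V nb_sym nb_deg_1 by blast+
  have "card (nb u) \<noteq> 1"
  proof
    assume "card (nb u) = 1"
    then have "nb u = {x}" using nb_deg_1 x by blast
    then have "{x, u} = V" using closed_subset_eq[of "{x, u}"] x by auto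
    moreover have "card {x, u} \<le> 2" by (simp add: card_insert_if)
    ultimately show False using card_V by simp
  qed
  moreover have "d x / 4 < S x" using single_ineq x by blast
  then have "1 / 4 < 1 / d u" using S_leaf[of x u] assms by simp
  then have "d u < 4" using d_pos[OF x(2)] by (simp add: field_simps)
  ultimately show ?thesis using deg_pos[OF x(2)] by linarith
qed

text \<open>The weight \<open>1/2\<close> is optimal for the path on four vertices.\<close>
lemma two_leaf_nbs_deg_2_False:
  assumes "card (nb x) = 1" "u \<in> nb x" "card (nb x') = 1" "v \<in> nb x'" "v \<in> nb u"
    and v2: "card (nb v) = 2"
  shows False
proof -
  have sym: "x \<in> nb u" "x' \<in> nb v" "u \<in> nb v" using assms nb_sym by blast+
  have u: "2 \<le> card (nb u)" using leaf_nb_deg assms by fastforce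
  then have "x' \<noteq> u" using assms by auto
  then have "nb v = {x', u}" using sym v2 nb_deg_2 by (metis insertE singletonD)
  then have Sv: "S v = 1 + 1 / d u" using assms \<open>x' \<noteq> u\<close> by (simp add: S_def)
  have "x \<noteq> v" using assms by auto
  then have "(d x + (1/2)\<^sup>2 * d v) / 4 < S x + (1/2)\<^sup>2 * S v - 2 * (1/2) / d u"
    using assms sym by (intro weighted_pair_ineq) auto
  then have "(1 + 1/2) / 4 < (1 + 1 / d u) / 4"
    using assms Sv S_leaf[of x u] by (simp add: power2_eq_square)
  moreover have "1 / d u \<le> 1 / 2" using inverse_d_le[OF u] by simp
  ultimately show False by simp
qed

text \<open>The previous lemma, applied in both directions, leaves only degree three for
  \<open>u\<close> and \<open>v\<close>; a test function on \<open>x\<close> and \<open>v\<close>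
  excludes that too.\<close>

lemma two_leaf_nbs_False:
  assumes "card (nb x) = 1" "u \<in> nb x" "card (nb x') = 1" "v \<in> nb x'" "v \<in> nb u"
  shows False
proof -
  have sym: "x \<in> nb u" "x' \<in> nb v" "u \<in> nb v" using assms nb_sym by blast+
  have "card (nb u) \<noteq> 2" using two_leaf_nbs_deg_2_False[of x' v x u] assms sym by blast
  then have u3: "card (nb u) = 3" using leaf_nb_deg assms by blast
  have "card (nb v) \<noteq> 2" using two_leaf_nbs_deg_2_False[of x u x' v] assms sym by blast
  then have v3: "card (nb v) = 3" using leaf_nb_deg assms by blast
  obtain a b where ab: "nb v = {x', a, b}" "x' \<noteq> a" "x' \<noteq> b" "a \<noteq> b"
    using nb_deg_3[OF v3 sym(2)] by blast
  have "u \<noteq> x'" using u3 assms by auto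
  then have "u = a \<or> u = b" using ab sym by auto
  then obtain k where k: "nb v = {x', u, k}" "k \<noteq> x'" "k \<noteq> u"
  proof
    assume "u = a"
    then show ?thesis using that[of b] ab by auto
  next
    assume "u = b"
    then show ?thesis using that[of a] ab by auto
  qed
  have "card (nb k) \<noteq> 1" using leaf_unique[of k v x'] k sym assms by blast
  then have "2 \<le> card (nb k)" using deg_pos[of k] nb_in_V[of k v] k by fastforce
  then have "1 / d k \<le> 1 / 2" using inverse_d_le[of 2 k] by simp
  then have Sv: "S v \<le> 1 + 1 / 3 + 1 / 2" using k assms u3 \<open>u \<noteq> x'\<close> by (simp add: S_def)
  have "x \<noteq> v" using assms v3 by auto
  \<comment> \<open>Given the bound on \<open>S v\<close>, any weight \<open>b\<close> with
    \<open>13 * b\<^sup>2 - 8 * b + 1 \<le> 0\<close> gives a contradiction; \<open>1 / 3\<close> is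
    close to the minimizer \<open>4 / 13\<close>.\<close>
  then have "(d x + (1/3)\<^sup>2 * d v) / 4 < S x + (1/3)\<^sup>2 * S v - 2 * (1/3) / d u"
    using assms sym by (intro weighted_pair_ineq) auto
  then show False using assms Sv u3 v3 S_leaf[of x u] by (simp add: power2_eq_square)
qed

text \<open>A leaf at \<open>v\<close> would put leaves at both ends of the edge between
  \<open>u\<close> and \<open>v\<close>.\<close>

lemma leaf_second_nb_leafless:
  assumes "card (nb x) = 1" "u \<in> nb x" "v \<in> nb u"
  shows "leafless v"
proof (rule ccontr)
  assume "\<not> leafless v"
  then obtain x' where x': "x' \<in> nb v" "\<not> 2 \<le> card (nb x')" by (auto simp: leafless_def)
  then have "card (nb x') = 1" using deg_pos[of x'] nb_in_V[of x' v] by simp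
  then show False using two_leaf_nbs_False[of x u x' v] assms x' nb_sym by blast
qed

text \<open>The test function is \<open>1\<close> at \<open>v\<close> and \<open>-1\<close> at the leaves at distance two from \<open>v\<close>; it averages
  to zero at every neighbour of \<open>v\<close> that carries a leaf.\<close>
lemma leaf_hub_ineq:
  assumes "card (nb x) = 1" "u \<in> nb x" "v \<in> nb u" "v \<noteq> x"
  shows "(d v + 1) / 4 < (\<Sum>w\<in>{w \<in> nb v. leafless w}. 1 / d w)"
proof -
  define X where "X = {z \<in> V. card (nb z) = 1 \<and> nb z \<inter> nb v \<noteq> {}}"
  define f :: "'a \<Rightarrow> real" where "f z = (if z = v then 1 else 0) - (if z \<in> X then 1 else 0)" for z
  have sym: "x \<in> nb u" "u \<in> nb v" using assms nb_sym by blast+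
  have inV: "x \<in> V" "u \<in> V" "v \<in> V" using assms nb_in_V by blast+
  have finX: "finite X" by (simp add: X_def)
  have "card (nb v) \<noteq> 1" using leaf_unique[of v u x] assms sym by blast
  then have vX: "v \<notin> X" by (simp add: X_def)
  have xX: "x \<in> X" using assms sym inV by (auto simp: X_def)
  have "f v \<noteq> 0" using vX by (simp add: f_def)
  then have *: "ip f f / 4 < ip (P f) (P f)" using gap inV by blast
  have "d z * (f z * f z) = (if z = v then d v else 0) + (if z \<in> X then 1 else 0)" for z
    using vX by (auto simp: f_def X_def)
  moreover have "(\<Sum>z\<in>V. if z \<in> X then 1 else 0 :: real) = real (card X)"
    by (simp add: sum.If_cases Int_absorb1 X_def Collect_conj_eq)
  ultimately have ff: "ip f f = d v + real (card X)"
    using inV by (simp add: ip_def sum.distrib)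
  \<comment> \<open>The leaf \<open>x\<close> lies in \<open>X\<close>, which accounts for the
    \<open>+ 1\<close> in the claim.\<close>
  have X1: "1 \<le> card X" using xX finX by (metis One_nat_def Suc_leI card_gt_0_iff empty_iff)
  have inner: "(\<Sum>z\<in>nb w. f z) = (if w \<in> nb v \<and> leafless w then 1 else 0)" if "w \<in> V" for w
  proof -
    have sum: "(\<Sum>z\<in>nb w. f z) = (if w \<in> nb v then 1 else 0) - real (card (nb w \<inter> X))"
      by (simp add: f_def sum_subtractf nb_sym[of v] sum.If_cases)
    consider "w \<notin> nb v" | "w \<in> nb v" "leafless w" | "w \<in> nb v" "\<not> leafless w" by blast
    then show ?thesis
    proof cases
      case 1
      have "nb w \<inter> X = {}"
      proof (rule ccontr)
        assume "nb w \<inter> X \<noteq> {}"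
        then obtain z where z: "z \<in> nb w" "card (nb z) = 1" "nb z \<inter> nb v \<noteq> {}"
          by (auto simp: X_def)
        then have "nb z = {w}" using nb_deg_1 nb_sym by blast
        then show False using z(3) 1 by auto
      qed
      then show ?thesis using sum 1 by simp
    next
      case 2
      then have "nb w \<inter> X = {}" by (force simp: X_def leafless_def)
      then show ?thesis using sum 2 by simp
    next
      case 3
      then obtain z where z: "z \<in> nb w" "\<not> 2 \<le> card (nb z)" by (auto simp: leafless_def)
      then have z1: "card (nb z) = 1" using deg_pos[of z] nb_in_V[of z w] by simp
      have "w \<in> nb z" using z nb_sym by blast
      then have "z \<in> X" using z1 3 nb_in_V by (auto simp: X_def)
      moreover have "z' = z" if "z' \<in> nb w \<inter> X" for z'
        using that leaf_unique[of z' w z] z z1 by (simp add: X_def)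
      ultimately have "nb w \<inter> X = {z}" using z by blast
      then show ?thesis using sum 3 by simp
    qed
  qed
  have "ip (P f) (P f) = (\<Sum>w\<in>V. if w \<in> {w \<in> nb v. leafless w} then 1 / d w else 0)"
    unfolding ip_P_P by (intro sum.cong) (auto simp: inner)
  also have "\<dots> = (\<Sum>w\<in>V \<inter> {w \<in> nb v. leafless w}. 1 / d w)"
    by (rule sum.inter_restrict[symmetric]) simp
  also have "V \<inter> {w \<in> nb v. leafless w} = {w \<in> nb v. leafless w}" using nb_subset by blast
  finally show ?thesis using * ff X1 by simp
qed

text \<open>The sum in \<open>leaf_hub_ineq\<close> has at most \<open>d v - 1\<close> terms,
  because \<open>u\<close> carries a leaf. Beyond \<open>1 / 4\<close> per term, at most one vertex
  of degree two adds \<open>1 / 4\<close> and each of degree three adds \<open>1 / 12\<close>, so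
  more than three of the latter are needed.\<close>

lemma leaf_hub_deg_3_nbs:
  assumes "card (nb x) = 1" "u \<in> nb x" "v \<in> nb u" "v \<noteq> x"
  shows "4 \<le> card {w \<in> nb v. leafless w \<and> card (nb w) = 3}" "5 \<le> card (nb v)"
proof -
  define L where "L = {w \<in> nb v. leafless w}"
  define D where "D = {w \<in> L. card (nb w) = 2}"
  define T where "T = {w \<in> L. card (nb w) = 3}"
  have fin: "finite L" "finite D" "finite T" by (auto simp: L_def D_def T_def)
  have sym: "x \<in> nb u" "u \<in> nb v" using assms nb_sym by blast+
  have "\<not> leafless u" using sym assms by (force simp: leafless_def)
  then have "L \<subset> nb v" using sym by (auto simp: L_def)
  then have L: "card L < card (nb v)" by (simp add: psubset_card_mono)
  have "p = p'" if "p \<in> D" "p' \<in> D" for p p'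
    using that deg_2_nb_unique[of p v p'] by (simp add: D_def L_def)
  then have D: "card D \<le> 1" using fin card_le_Suc0_iff_eq by (metis One_nat_def)
  have "1 / d w \<le> 1 / 4 + ((if w \<in> D then 1 / 4 else 0) + (if w \<in> T then 1 / 12 else 0))"
    if "w \<in> L" for w
  proof -
    have "2 \<le> card (nb w)"
      using that leaf_second_nb_leafless[of x u v] assms by (auto simp: L_def leafless_def)
    then consider "card (nb w) = 2" | "card (nb w) = 3" | "4 \<le> card (nb w)" by linarith
    then show ?thesis using that inverse_d_le[of 4 w] by cases (auto simp: D_def T_def)
  qed
  then have "(\<Sum>w\<in>L. 1 / d w)
      \<le> (\<Sum>w\<in>L. 1 / 4 + ((if w \<in> D then 1 / 4 else 0) + (if w \<in> T then 1 / 12 else 0)))"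
    by (rule sum_mono)
  also have "\<dots> = card L / 4 + (card D / 4 + card T / 12)"
  proof -
    have "L \<inter> D = D" "L \<inter> T = T" by (auto simp: D_def T_def)
    then show ?thesis using fin by (simp add: sum.distrib sum.If_cases)
  qed
  finally have "(d v + 1) / 4 < card L / 4 + (card D / 4 + card T / 12)"
    using leaf_hub_ineq[OF assms] by (simp add: L_def)
  moreover have "real (card L) \<le> d v - 1" "real (card D) \<le> 1" using L D by auto
  ultimately have "3 < real (card T)" by (simp add: field_simps)
  then have T: "4 \<le> card T" by simp
  then show "4 \<le> card {w \<in> nb v. leafless w \<and> card (nb w) = 3}"
    by (simp add: T_def L_def conj_assoc)
  have "card T \<le> card L" using fin by (intro card_mono) (auto simp: T_def)
  then show "5 \<le> card (nb v)" using T L by linarith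
qed

text \<open>If \<open>p\<close> carried a leaf, \<open>y\<close> would be at distance two from it,
  hence of degree at least five.\<close>

lemma leafless_if_small_nb:
  assumes "y \<in> nb p" "2 \<le> card (nb y)" "card (nb y) < 5"
  shows "leafless p"
proof (rule ccontr)
  assume "\<not> leafless p"
  then obtain x where x: "x \<in> nb p" "\<not> 2 \<le> card (nb x)" by (auto simp: leafless_def)
  then have "card (nb x) = 1" using deg_pos[of x] nb_in_V[of x p] by simp
  moreover have "p \<in> nb x" using x nb_sym by blast
  ultimately have "5 \<le> card (nb y)" using leaf_hub_deg_3_nbs(2)[of x p y] x assms by blast
  then show False using assms by simp
qed

text \<open>With \<open>3 / 4\<close>, two such neighbours contradict \<open>pair_ineq\<close> at
  \<open>v\<close>. A violation forces the other neighbours \<open>p\<close>, \<open>r\<close> of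
  \<open>y\<close> to have degrees two and three, and the second neighbour \<open>q\<close> of
  \<open>p\<close> to have degree two; then \<open>pair_ineq\<close> fails for \<open>y\<close> and
  \<open>q\<close>.\<close>

lemma hub_deg_3_nb_bound:
  assumes v: "5 \<le> card (nb v)" and y: "y \<in> nb v" "card (nb y) = 3" "leafless y"
  shows "S y \<le> 1 / d v + 3 / 4"
proof (rule ccontr)
  assume "\<not> ?thesis"
  then have Sy: "1 / d v + 3 / 4 < S y" by simp
  have "v \<in> nb y" using y nb_sym by blast
  then obtain a b where ab: "nb y = {v, a, b}" "v \<noteq> a" "v \<noteq> b" "a \<noteq> b"
    using nb_deg_3[OF y(2)] by blast
  obtain p r where pr: "nb y = {v, p, r}" "v \<noteq> p" "v \<noteq> r" "p \<noteq> r" "card (nb p) \<le> card (nb r)"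
  proof (cases "card (nb a) \<le> card (nb b)")
    case True
    then show ?thesis using that ab by blast
  next
    case False
    moreover have "nb y = {v, b, a}" using ab by blast
    ultimately show ?thesis using that[of b a] ab by auto
  qed
  have Sy_eq: "S y = 1 / d v + (1 / d p + 1 / d r)" using pr by (simp add: S_def)
  have pr_ge2: "2 \<le> card (nb p)" "2 \<le> card (nb r)" using y pr by (auto simp: leafless_def)
  have sym: "y \<in> nb p" "y \<in> nb r" "p \<in> nb y" "r \<in> nb y" using pr nb_sym[of y] by auto
  have leafless_pr: "leafless p" "leafless r"
    using leafless_if_small_nb[of y] sym y by auto
  have p2: "card (nb p) = 2"
  proof (rule ccontr)
    assume "card (nb p) \<noteq> 2"
    then have "3 \<le> card (nb p)" "3 \<le> card (nb r)" using pr pr_ge2 by auto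
    then have "1 / d p \<le> 1 / 3" "1 / d r \<le> 1 / 3"
      using inverse_d_le[of 3 p] inverse_d_le[of 3 r] by auto
    then show False using Sy Sy_eq by linarith
  qed
  have "card (nb r) \<noteq> 2" using deg_2_nb_unique[of p y r] p2 leafless_pr sym pr by blast
  moreover have "\<not> 4 \<le> card (nb r)"
    using inverse_d_le[of 4 r] p2 Sy Sy_eq by auto
  ultimately have r3: "card (nb r) = 3" using pr_ge2 by linarith
  obtain q where q: "nb p = {y, q}" "y \<noteq> q" using nb_deg_2[OF p2 sym(1)] by blast
  have pq: "p \<in> nb q" using q nb_sym by blast
  have q_ge2: "2 \<le> card (nb q)" using q leafless_pr by (simp add: leafless_def)
  have Sp: "S p = 1 / 3 + 1 / d q" using q y by (simp add: S_def)
  have "w = w'"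
    if "w \<in> nb r" "w' \<in> nb r" "card (nb w) < 3" "card (nb w') < 3" for w w'
  proof -
    have "2 \<le> card (nb w)" "2 \<le> card (nb w')" using that leafless_pr by (auto simp: leafless_def)
    moreover have "leafless w" "leafless w'"
      using leafless_if_small_nb[of r] r3 that nb_sym[of r] by auto
    ultimately show ?thesis using deg_2_nb_unique[of w r w'] that by linarith
  qed
  then have "S r \<le> 1 / 2 + (d r - 1) / 3"
    using S_le_at_most_one[of r 2 3] leafless_pr sym nb_in_V[of r y] by (auto simp: leafless_def)
  moreover have "(d p + d r) / 4 < S p + S r - 2 / d y" using pair_ineq sym pr by blast
  \<comment> \<open>The inequalities give even \<open>5 / 12 < 1 / d q\<close>; \<open>1 / 3\<close>
    is enough to exclude degree three.\<close>
  ultimately have "1 / 3 < 1 / d q" using Sp p2 r3 y by simp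
  then have "d q < 3" using q_ge2 by (simp add: field_simps)
  then have q2: "card (nb q) = 2" using q_ge2 by linarith
  have "leafless q" using leafless_if_small_nb[of p q] pq p2 by simp
  then have "S q \<le> 1 / 2 + (d q - 1) / 2"
    using S_le[of p q 2 2] pq p2 by (auto simp: leafless_def)
  moreover have "(d y + d q) / 4 < S y + S q - 2 / d p" using pair_ineq sym pq q by blast
  moreover have "1 / d v \<le> 1 / 5" using inverse_d_le[OF v] by simp
  \<comment> \<open>\<open>S y\<close> would have to exceed \<open>5 / 4\<close>, but it is at most
    \<open>1 / 5 + 5 / 6\<close>.\<close>
  ultimately show False using Sy_eq p2 r3 q2 y by simp
qed

text \<open>For two leafless neighbours of degree three of a vertex \<open>v\<close> at distance two
  from the leaf, the terms in \<open>d v\<close> cancel in \<open>pair_ineq\<close> and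
  \<open>3 / 2 < 3 / 2\<close> remains.\<close>

lemma no_leaf:
  assumes "x \<in> V"
  shows "card (nb x) \<noteq> 1"
proof
  assume x: "card (nb x) = 1"
  then obtain u where u: "nb x = {u}" by (rule card_1_singletonE)
  then have xu: "u \<in> nb x" "x \<in> nb u" using nb_sym by blast+
  have "\<not> nb u \<subseteq> {x}"
    using leaf_nb_deg[OF x xu(1)] card_mono[of "{x}" "nb u"] by auto
  then obtain v where v: "v \<in> nb u" "v \<noteq> x" by blast
  define T where "T = {w \<in> nb v. leafless w \<and> card (nb w) = 3}"
  have T4: "4 \<le> card T" and v5: "5 \<le> card (nb v)"
    using leaf_hub_deg_3_nbs[OF x xu(1) v] by (auto simp: T_def)
  have "\<not> card T \<le> Suc 0" using T4 by simp
  moreover have "finite T" by (simp add: T_def)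
  ultimately obtain y z where yz: "y \<in> T" "z \<in> T" "y \<noteq> z" by (auto simp: card_le_Suc0_iff_eq)
  then have "(d y + d z) / 4 < S y + S z - 2 / d v"
    using nb_sym[of v] by (intro pair_ineq) (auto simp: T_def)
  moreover have "S y \<le> 1 / d v + 3 / 4" "S z \<le> 1 / d v + 3 / 4"
    using hub_deg_3_nb_bound[OF v5] yz by (auto simp: T_def)
  ultimately show False using yz by (simp add: T_def)
qed

lemma inconsistent: False
proof (rule min_deg_2_False)
  show "2 \<le> card (nb v)" if "v \<in> V" for v
    using no_leaf[OF that] deg_pos[OF that] by linarith
qed

end

section \<open>Eigenvalues\<close>

context big_graph
begin

section \<open>Self-adjointness of \<open>P\<close>\<close>

lemma nb_outside: "v \<notin> V \<Longrightarrow> nb v = {}"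
  using nb_in_V by blast

lemma P_outside: "v \<notin> V \<Longrightarrow> P f v = 0"
  by (simp add: P_def nb_outside)

lemma ip_cong: "(\<And>v. v \<in> V \<Longrightarrow> f v = f' v) \<Longrightarrow> (\<And>v. v \<in> V \<Longrightarrow> g v = g' v) \<Longrightarrow> ip f g = ip f' g'"
  by (simp add: ip_def)

lemma ip_commute: "ip f g = ip g f"
  by (simp add: ip_def mult.commute)

lemma ip_add_scaled:
  "ip (\<lambda>v. f v + t * g v) (\<lambda>v. f v + t * g v) = ip f f + 2 * t * ip f g + t\<^sup>2 * ip g g"
  by (simp add: ip_def sum_distrib_left sum.distrib[symmetric] power2_eq_square algebra_simps)

lemma ip_scale_left: "ip (\<lambda>v. c * f v) g = c * ip f g"
  by (simp add: ip_def sum_distrib_left mult_ac)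

lemma ip_scale_right: "ip f (\<lambda>v. c * g v) = c * ip f g"
  by (simp add: ip_def sum_distrib_left mult_ac)

lemma ip_sum_right: "ip f (\<lambda>v. \<Sum>i\<in>F. c i * e i v) = (\<Sum>i\<in>F. c i * ip f (e i))"
  unfolding ip_def sum_distrib_left by (subst sum.swap) (simp add: mult_ac)

lemma ip_nonneg: "0 \<le> ip f f"
  by (auto simp: ip_def intro!: sum_nonneg)

lemma ip_pos:
  assumes "v \<in> V" "f v \<noteq> 0"
  shows "0 < ip f f"
  unfolding ip_def
  using assms d_pos[of v] by (intro sum_pos2[of V v]) (auto simp: zero_less_mult_iff)

text \<open>The weight \<open>d v\<close> cancels the denominator in \<open>P\<close>, leaving a sum
  over adjacent pairs that is symmetric in its two indices.\<close>

lemma ip_P: "ip (P f) g = ip f (P g)"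
proof -
  have left: "ip (P f) g = (\<Sum>v\<in>V. \<Sum>w\<in>V. if w \<in> nb v then f w * g v else 0)" for f g
    unfolding ip_def
  proof (rule sum.cong)
    fix v assume "v \<in> V"
    then have "d v * (P f v * g v) = (\<Sum>w\<in>nb v. f w * g v)"
      using d_pos[of v] by (simp add: P_def sum_distrib_right)
    then show "d v * (P f v * g v) = (\<Sum>w\<in>V. if w \<in> nb v then f w * g v else 0)"
      by (simp add: sum_nb)
  qed simp
  have "ip (P f) g = (\<Sum>w\<in>V. \<Sum>v\<in>V. if w \<in> nb v then f w * g v else 0)"
    unfolding left by (rule sum.swap)
  also have "\<dots> = ip (P g) f"
    unfolding left by (intro sum.cong refl) (simp add: nb_sym mult.commute)
  finally show ?thesis by (simp add: ip_commute)
qed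

lemma P_add_scaled: "P (\<lambda>v. f v + t * g v) = (\<lambda>v. P f v + t * P g v)"
  by (simp add: P_def sum.distrib sum_distrib_left[symmetric] add_divide_distrib)

lemma P_scale: "P (\<lambda>v. c * f v) = (\<lambda>v. c * P f v)"
  by (simp add: P_def sum_distrib_left[symmetric])

lemma ip_P_pow: "ip ((P ^^ l) f) g = ip f ((P ^^ l) g)"
  by (induction l arbitrary: g) (simp_all add: ip_P, simp add: funpow_swap1)

lemma P_pow_eigen:
  assumes "P f = (\<lambda>v. \<mu> * f v)"
  shows "(P ^^ l) f = (\<lambda>v. \<mu> ^ l * f v)"
proof (induction l)
  case (Suc l)
  have "(P ^^ Suc l) f = (\<lambda>v. \<mu> ^ l * (\<mu> * f v))"
    by (simp only: funpow.simps o_apply Suc P_scale assms)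
  then show ?case by (simp add: mult_ac)
qed simp

section \<open>Minimizing the Rayleigh quotient of the square of \<open>P\<close>\<close>

lemma compact_unit_sphere: "compact {f. (\<forall>v. v \<notin> V \<longrightarrow> f v = 0) \<and> ip f f = 1}"
proof -
  \<comment> \<open>Degrees of at least one bound the coordinates in \<open>V\<close> by one, and
    the others are pinned to zero, so the sphere is closed in a compact product even over an
    infinite type.\<close>
  define B :: "'a \<Rightarrow> real set" where "B v = (if v \<in> V then {-1..1} else {0})" for v
  define K where "K = {f. ip f f = 1}"
  have "compactin (product_topology (\<lambda>_. euclidean) UNIV) (Pi\<^sub>E UNIV B)"
    by (auto simp: compactin_PiE B_def)
  then have "compact (Pi\<^sub>E UNIV B)" by (simp add: euclidean_product_topology)
  moreover have "continuous_on UNIV (\<lambda>f. ip f f)"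
    unfolding ip_def by (intro continuous_intros continuous_on_product_coordinates)
  then have "closed K" unfolding K_def by (intro closed_Collect_eq) auto
  ultimately have "compact (Pi\<^sub>E UNIV B \<inter> K)" by (rule compact_Int_closed)
  moreover have "Pi\<^sub>E UNIV B \<inter> K = {f. (\<forall>v. v \<notin> V \<longrightarrow> f v = 0) \<and> ip f f = 1}"
  proof -
    have "\<bar>f v\<bar> \<le> 1" if "ip f f = 1" "v \<in> V" for f v
    proof -
      have "1 * (f v * f v) \<le> d v * (f v * f v)"
        using deg_pos[OF that(2)] by (intro mult_right_mono) auto
      also have "\<dots> \<le> ip f f"
        unfolding ip_def using that by (intro member_le_sum) auto
      finally have "(f v)\<^sup>2 \<le> 1" using that by (simp add: power2_eq_square)
      then show ?thesis by (simp add: abs_square_le_1)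
    qed
    then show ?thesis
      by (auto simp: B_def K_def PiE_iff abs_le_iff split: if_splits)
  qed
  ultimately show ?thesis by simp
qed

text \<open>For small \<open>t\<close> the linear term dominates; \<open>t = - B / k\<close> with
  \<open>k\<close> above the modulus of \<open>C\<close> makes the sum negative.\<close>

lemma linear_coeff_zero:
  fixes B C :: real
  assumes "\<And>t. 0 \<le> 2 * t * B + t\<^sup>2 * C"
  shows "B = 0"
proof (rule ccontr)
  assume B: "B \<noteq> 0"
  define k where "k = \<bar>C\<bar> + 1"
  have k: "0 < k" "C \<le> k" by (auto simp: k_def)
  have "0 \<le> 2 * (- B / k) * B + (- B / k)\<^sup>2 * C" by (rule assms)
  also have "\<dots> \<le> 2 * (- B / k) * B + (- B / k)\<^sup>2 * k"
    using k by (intro add_left_mono mult_left_mono) auto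
  also have "\<dots> = - (B\<^sup>2 / k)" using k by (simp add: power2_eq_square field_simps)
  also have "\<dots> < 0" using k B by simp
  finally show False by simp
qed

text \<open>A minimizer exists by compactness; vanishing of its first variation, with
  \<open>P\<close> moved across by self-adjointness, is the eigenvalue equation.\<close>

lemma min_rayleigh_quotient:
  obtains f m where "\<And>v. v \<notin> V \<Longrightarrow> f v = 0" "\<exists>v\<in>V. f v \<noteq> 0" "P (P f) = (\<lambda>v. m * f v)"
    "\<And>g. m * ip g g \<le> ip (P g) (P g)" "0 \<le> m"
proof -
  define K where "K = {f. (\<forall>v. v \<notin> V \<longrightarrow> f v = 0) \<and> ip f f = 1}"
  have normalize: "(\<lambda>v. if v \<in> V then g v / sqrt (ip g g) else 0) \<in> K" if "0 < ip g g" for g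
  proof -
    define h where "h v = (if v \<in> V then g v / sqrt (ip g g) else 0)" for v
    have "ip h h = ip (\<lambda>v. (1 / sqrt (ip g g)) * g v) (\<lambda>v. (1 / sqrt (ip g g)) * g v)"
      by (rule ip_cong) (auto simp: h_def)
    also have "\<dots> = 1" using that unfolding ip_scale_left ip_scale_right by simp
    finally have "h \<in> K" by (simp add: K_def h_def)
    moreover have "h = (\<lambda>v. if v \<in> V then g v / sqrt (ip g g) else 0)" by (simp add: h_def fun_eq_iff)
    ultimately show ?thesis by simp
  qed
  obtain u where u: "u \<in> V" using card_V by fastforce
  then have "0 < ip (\<lambda>_. 1) (\<lambda>_. 1)" by (intro ip_pos) auto
  then have "K \<noteq> {}" using normalize by blast
  moreover have "continuous_on K (\<lambda>f. ip (P f) (P f))"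
    unfolding ip_P_P
    by (intro continuous_intros continuous_on_product_coordinates
        continuous_on_subset[OF continuous_on_product_coordinates]) (use d_pos in fastforce)+
  ultimately obtain f where f: "f \<in> K" and min: "\<And>h. h \<in> K \<Longrightarrow> ip (P f) (P f) \<le> ip (P h) (P h)"
    using continuous_attains_inf[of K "\<lambda>f. ip (P f) (P f)"] compact_unit_sphere
    unfolding K_def[symmetric] by blast
  define m where "m = ip (P f) (P f)"
  have ff: "ip f f = 1" and f0: "\<And>v. v \<notin> V \<Longrightarrow> f v = 0" using f by (auto simp: K_def)
  have m_le: "m * ip g g \<le> ip (P g) (P g)" for g
  proof (cases "ip g g = 0")
    case True
    then show ?thesis by (simp add: ip_nonneg)
  next
    case False
    then have pos: "0 < ip g g" using ip_nonneg[of g] by simp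
    define h where "h v = (if v \<in> V then g v / sqrt (ip g g) else 0)" for v
    have Ph: "P h = P (\<lambda>v. (1 / sqrt (ip g g)) * g v)"
      unfolding P_def using nb_in_V by (intro ext arg_cong2[of _ _ _ _ "(/)"] sum.cong) (auto simp: h_def)
    have "ip (P h) (P h) = ip (P g) (P g) / ip g g"
      unfolding Ph P_scale ip_scale_left ip_scale_right using pos by simp
    moreover have "m \<le> ip (P h) (P h)"
      using min[OF normalize[OF pos]] unfolding m_def h_def .
    ultimately show ?thesis using pos by (simp only: pos_le_divide_eq)
  qed
  have var: "ip (P (P f)) g - m * ip f g = 0" for g
  proof (rule linear_coeff_zero)
    fix t
    show "0 \<le> 2 * t * (ip (P (P f)) g - m * ip f g) + t\<^sup>2 * (ip (P g) (P g) - m * ip g g)"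
      using m_le[of "\<lambda>v. f v + t * g v"]
      unfolding P_add_scaled ip_add_scaled ff m_def[symmetric] ip_P[of "P f" g]
      by (simp add: algebra_simps)
  qed
  have "P (P f) v = m * f v" for v
  proof (cases "v \<in> V")
    case True
    \<comment> \<open>A point mass as test function turns \<open>var\<close> into an equation at
      \<open>v\<close>.\<close>
    have "ip h (\<lambda>w. if w = v then 1 else 0) = d v * h v" for h
    proof -
      have "d w * (h w * (if w = v then 1 else 0)) = (if w = v then d v * h v else 0)" for w
        by simp
      then show ?thesis using True by (simp add: ip_def)
    qed
    then have "d v * (P (P f) v - m * f v) = 0"
      using var[of "\<lambda>w. if w = v then 1 else 0"] by (simp add: algebra_simps)
    then show ?thesis using d_pos[OF True] by auto
  next
    case False
    then show ?thesis by (simp add: P_outside f0)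
  qed
  then have "P (P f) = (\<lambda>v. m * f v)" by blast
  moreover have "\<exists>v\<in>V. f v \<noteq> 0"
  proof (rule ccontr)
    assume "\<not> ?thesis"
    then have "ip f f = 0" by (simp add: ip_def)
    then show False using ff by simp
  qed
  ultimately show ?thesis using that f0 m_le ip_nonneg unfolding m_def by blast
qed

text \<open>For \<open>s = sqrt m\<close>, \<open>(P - s) (P + s) f = 0\<close>: either
  \<open>h = P f + s f\<close> is an eigenfunction for \<open>s\<close>, or it vanishes and
  \<open>f\<close> is one for \<open>- s\<close>.\<close>

lemma small_eigenfunction:
  obtains f \<mu> where "\<And>v. v \<notin> V \<Longrightarrow> f v = 0" "\<exists>v\<in>V. f v \<noteq> 0" "P f = (\<lambda>v. \<mu> * f v)" "\<bar>\<mu>\<bar> \<le> 1 / 2"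
proof -
  \<comment> \<open>The failure of the gap supplies a competitor \<open>g\<close> that bounds the
    minimum \<open>m\<close> by \<open>1 / 4\<close>.\<close>
  have "\<not> gapped_graph V E" using gapped_graph.inconsistent by blast
  then obtain g v where g: "v \<in> V" "g v \<noteq> 0" "ip (P g) (P g) \<le> ip g g / 4"
    unfolding gapped_graph_def gapped_graph_axioms_def using big_graph_axioms by force
  obtain f m where f: "\<And>v. v \<notin> V \<Longrightarrow> f v = 0" "\<exists>v\<in>V. f v \<noteq> 0" "P (P f) = (\<lambda>v. m * f v)"
    and m: "\<And>g. m * ip g g \<le> ip (P g) (P g)" "0 \<le> m"
    by (rule min_rayleigh_quotient) blast
  have m_le: "m * ip g g \<le> (1 / 4) * ip g g" using m(1)[of g] g by simp
  have m4: "m \<le> 1 / 4" by (rule mult_right_le_imp_le[OF m_le ip_pos[of v g, OF g(1,2)]])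
  define s where "s = sqrt m"
  have s: "0 \<le> s" "m = s * s" using m by (auto simp: s_def)
  have "sqrt m \<le> sqrt (1 / 4)" using m4 by simp
  then have s2: "s \<le> 1 / 2" by (simp add: s_def real_sqrt_divide)
  define h where "h v = P f v + s * f v" for v
  have "P h = (\<lambda>v. s * h v)"
    unfolding h_def P_add_scaled f(3) by (simp add: s algebra_simps)
  moreover have "h v = 0" if "v \<notin> V" for v using that by (simp add: h_def P_outside f)
  moreover have "P f = (\<lambda>v. - s * f v)" if "\<not> (\<exists>v\<in>V. h v \<noteq> 0)"
  proof
    fix v
    have "h v = 0" using that calculation(2) by blast
    then show "P f v = - s * f v" by (simp add: h_def)
  qed
  ultimately show ?thesis using that[of h s] that[of f "- s"] f s s2
    by (cases "\<exists>v\<in>V. h v \<noteq> 0") auto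
qed

section \<open>Eigenvalues of the neighbourhood Laplacian\<close>

lemma is_nbhd_eigenvalue_iff:
  "is_nbhd_eigenvalue V E l \<mu> \<longleftrightarrow>
     (\<exists>f. (\<forall>v. v \<notin> V \<longrightarrow> f v = 0) \<and> (\<exists>v\<in>V. f v \<noteq> 0) \<and> (\<forall>v\<in>V. (P ^^ l) f v = (1 - \<mu>) * f v))"
proof -
  have "(\<lambda>g u. g u - nlap V E g u) = P"
    by (intro ext) (simp add: nlap_def P_def deg_def nb_def)
  moreover have "y - q = \<mu> * y \<longleftrightarrow> q = (1 - \<mu>) * y" for y q :: real
    by (auto simp: algebra_simps)
  ultimately show ?thesis
    by (simp only: is_nbhd_eigenvalue_def nbhd_lap_def)
qed

lemma nbhd_eigenvalue_near_1: "\<exists>\<mu>. is_nbhd_eigenvalue V E l \<mu> \<and> \<bar>1 - \<mu>\<bar> \<le> 1 / 2 ^ l"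
proof -
  obtain f \<nu> where f: "\<And>v. v \<notin> V \<Longrightarrow> f v = 0" "\<exists>v\<in>V. f v \<noteq> 0" "P f = (\<lambda>v. \<nu> * f v)"
    and \<nu>: "\<bar>\<nu>\<bar> \<le> 1 / 2"
    by (rule small_eigenfunction) blast
  have "is_nbhd_eigenvalue V E l (1 - \<nu> ^ l)"
    unfolding is_nbhd_eigenvalue_iff using f P_pow_eigen[OF f(3), of l] by (intro exI[of _ f]) auto
  moreover have "\<bar>\<nu> ^ l\<bar> \<le> (1 / 2) ^ l" unfolding power_abs using \<nu> by (intro power_mono) auto
  ultimately show ?thesis by (auto simp: power_one_over)
qed

text \<open>Bessel's inequality for the point masses, summed over all vertices.\<close>
lemma card_orthonormal_le:
  assumes "finite F" and orth: "\<And>i j. i \<in> F \<Longrightarrow> j \<in> F \<Longrightarrow> ip (e i) (e j) = (if i = j then 1 else 0)"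
  shows "card F \<le> card V"
proof -
  have bessel: "(\<Sum>i\<in>F. d x * (e i x * e i x)) \<le> 1" if x: "x \<in> V" for x
  proof -
    define g where "g v = (if v = x then 1 else 0 :: real)" for v
    define c where "c i = d x * e i x" for i
    define s where "s v = (\<Sum>i\<in>F. c i * e i v)" for v
    have gh: "ip g h = d x * h x" for h
    proof -
      have "d v * (g v * h v) = (if v = x then d x * h x else 0)" for v
        by (simp add: g_def)
      then show ?thesis using x by (simp add: ip_def)
    qed
    have gs: "ip g s = (\<Sum>i\<in>F. c i * c i)"
      unfolding s_def ip_sum_right unfolding gh c_def ..
    have es: "ip s (e i) = c i" if "i \<in> F" for i
    proof -
      have "ip (e i) s = (\<Sum>j\<in>F. if j = i then c i else 0)"
        unfolding s_def ip_sum_right using that by (intro sum.cong) (simp_all add: orth)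
      then show ?thesis using that assms(1) by (simp add: ip_commute[of s "e i"])
    qed
    have ss: "ip s s = (\<Sum>i\<in>F. c i * c i)"
    proof -
      have "ip s s = (\<Sum>i\<in>F. c i * ip s (e i))"
        using ip_sum_right[of s c e F] unfolding s_def[abs_def] .
      then show ?thesis by (simp add: es)
    qed
    \<comment> \<open>The squared norm of the residual \<open>g - s\<close>, expanded with
      \<open>t = -1\<close>.\<close>
    have "0 \<le> ip g g + 2 * (-1) * ip g s + (-1)\<^sup>2 * ip s s"
      unfolding ip_add_scaled[symmetric] by (rule ip_nonneg)
    moreover have "ip g g = d x" by (simp add: gh g_def)
    ultimately have "(\<Sum>i\<in>F. c i * c i) \<le> d x * 1" by (simp add: gs ss)
    moreover have "(\<Sum>i\<in>F. c i * c i) = d x * (\<Sum>i\<in>F. d x * (e i x * e i x))"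
      by (simp add: c_def sum_distrib_left mult_ac)
    ultimately show ?thesis using d_pos[OF x] by (simp only: mult_le_cancel_left_pos)
  qed
  have "real (card F) = (\<Sum>i\<in>F. ip (e i) (e i))" using orth by simp
  also have "\<dots> = (\<Sum>x\<in>V. \<Sum>i\<in>F. d x * (e i x * e i x))" unfolding ip_def by (rule sum.swap)
  also have "\<dots> \<le> (\<Sum>x\<in>V. 1)" using bessel by (rule sum_mono)
  finally show ?thesis by simp
qed

text \<open>Finiteness gives \<open>Max\<close> in \<open>largest_nbhd_eigenvalue\<close> its
  meaning. Eigenfunctions of the self-adjoint \<open>P ^^ l\<close> for distinct eigenvalues are
  orthogonal, so there are at most \<open>card V\<close> of them.\<close>

lemma finite_nbhd_eigenvalues: "finite {\<mu>. is_nbhd_eigenvalue V E l \<mu>}"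
proof (rule ccontr)
  assume "infinite {\<mu>. is_nbhd_eigenvalue V E l \<mu>}"
  then obtain F where F: "F \<subseteq> {\<mu>. is_nbhd_eigenvalue V E l \<mu>}" "finite F" "card F = Suc (card V)"
    using infinite_arbitrarily_large by blast
  have "\<exists>f. ip f f = 1 \<and> (\<forall>v\<in>V. (P ^^ l) f v = (1 - \<mu>) * f v)" if \<mu>: "\<mu> \<in> F" for \<mu>
  proof -
    obtain f v where f: "v \<in> V" "f v \<noteq> 0" "\<forall>v\<in>V. (P ^^ l) f v = (1 - \<mu>) * f v"
      using F \<mu> by (auto simp: is_nbhd_eigenvalue_iff)
    define k where "k = 1 / sqrt (ip f f)"
    have "ip (\<lambda>v. k * f v) (\<lambda>v. k * f v) = 1"
      unfolding ip_scale_left ip_scale_right using ip_pos[of v f, OF f(1,2)] by (simp add: k_def)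
    moreover have "(P ^^ l) (\<lambda>v. k * f v) = (\<lambda>v. k * (P ^^ l) f v)"
      by (induction l) (simp_all add: P_scale)
    ultimately show ?thesis using f(3) by (intro exI[of _ "\<lambda>v. k * f v"]) simp
  qed
  then obtain e where e: "\<And>\<mu>. \<mu> \<in> F \<Longrightarrow> ip (e \<mu>) (e \<mu>) = 1"
    "\<And>\<mu> v. \<mu> \<in> F \<Longrightarrow> v \<in> V \<Longrightarrow> (P ^^ l) (e \<mu>) v = (1 - \<mu>) * e \<mu> v"
    by metis
  have "ip (e \<mu>) (e \<nu>) = (if \<mu> = \<nu> then 1 else 0)" if "\<mu> \<in> F" "\<nu> \<in> F" for \<mu> \<nu>
  proof -
    have "(1 - \<mu>) * ip (e \<mu>) (e \<nu>) = ip ((P ^^ l) (e \<mu>)) (e \<nu>)"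
      unfolding ip_scale_left[symmetric] by (rule ip_cong) (simp_all add: e that)
    also have "\<dots> = ip (e \<mu>) ((P ^^ l) (e \<nu>))" by (rule ip_P_pow)
    also have "\<dots> = (1 - \<nu>) * ip (e \<mu>) (e \<nu>)"
      unfolding ip_scale_right[symmetric] by (rule ip_cong) (simp_all add: e that)
    finally show ?thesis using e(1) that by auto
  qed
  then show False using card_orthonormal_le[of F e] F by simp
qed

text \<open>The quadratic form of \<open>P ^^ (2 * k)\<close> is the squared norm of
  \<open>P ^^ k\<close>. Used with \<open>c = 0\<close> for the general upper bound and with
  \<open>c = 1 / 4\<close> for the triangle.\<close>

lemma nbhd_eigenvalue_le:
  assumes "is_nbhd_eigenvalue V E (2 * k) \<mu>" "0 \<le> c" "\<And>g. c * ip g g \<le> ip (P g) (P g)"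
  shows "\<mu> \<le> 1 - c ^ k"
proof -
  obtain f v where f: "v \<in> V" "f v \<noteq> 0" "\<forall>v\<in>V. (P ^^ (2 * k)) f v = (1 - \<mu>) * f v"
    using assms by (auto simp: is_nbhd_eigenvalue_iff)
  have "c ^ j * ip f f \<le> ip ((P ^^ j) f) ((P ^^ j) f)" for j
  proof (induction j)
    case (Suc j)
    have "c ^ Suc j * ip f f \<le> c * ip ((P ^^ j) f) ((P ^^ j) f)"
      using mult_left_mono[OF Suc assms(2)] by (simp add: mult_ac)
    also have "\<dots> \<le> ip ((P ^^ Suc j) f) ((P ^^ Suc j) f)" using assms(3) by simp
    finally show ?case .
  qed simp
  then have "c ^ k * ip f f \<le> ip ((P ^^ k) f) ((P ^^ k) f)" .
  also have "\<dots> = ip ((P ^^ (2 * k)) f) f" by (simp add: ip_P_pow mult_2 funpow_add ip_commute)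
  also have "\<dots> = (1 - \<mu>) * ip f f"
    unfolding ip_scale_left[symmetric] using f(3) by (intro ip_cong) simp_all
  finally show ?thesis using ip_pos[of v f, OF f(1,2)] by simp
qed

lemma largest_nbhd_eigenvalue_ge:
  "is_nbhd_eigenvalue V E l \<mu> \<Longrightarrow> \<mu> \<le> largest_nbhd_eigenvalue V E l"
  unfolding largest_nbhd_eigenvalue_def by (intro Max_ge finite_nbhd_eigenvalues) simp

lemma largest_nbhd_eigenvalue_is: "is_nbhd_eigenvalue V E l (largest_nbhd_eigenvalue V E l)"
  using Max_in[OF finite_nbhd_eigenvalues, of l] nbhd_eigenvalue_near_1[of l]
  unfolding largest_nbhd_eigenvalue_def by blast

lemma largest_nbhd_eigenvalue_lower: "1 - 1 / 2 ^ l \<le> largest_nbhd_eigenvalue V E l"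
proof -
  obtain \<mu> where "is_nbhd_eigenvalue V E l \<mu>" "\<bar>1 - \<mu>\<bar> \<le> 1 / 2 ^ l"
    using nbhd_eigenvalue_near_1 by blast
  then show ?thesis using largest_nbhd_eigenvalue_ge[of l \<mu>] by linarith
qed

lemma largest_nbhd_eigenvalue_upper:
  assumes "even l" "1 \<le> l"
  shows "largest_nbhd_eigenvalue V E l \<le> 1"
proof -
  obtain k where k: "l = 2 * k" using assms(1) by (rule evenE)
  have "largest_nbhd_eigenvalue V E (2 * k) \<le> 1 - 0 ^ k"
    by (rule nbhd_eigenvalue_le[OF largest_nbhd_eigenvalue_is]) (simp_all add: ip_nonneg)
  \<comment> \<open>Here \<open>l\<close> being positive matters, since
    \<open>0 ^ 0 = 1\<close>.\<close>
  moreover have "0 ^ k = (0 :: real)" using k assms(2) by (simp add: power_0_left)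
  ultimately show ?thesis by (simp add: k)
qed

end

section \<open>Extremal graphs\<close>

lemma triangle_largest_nbhd_eigenvalue:
  fixes V :: "nat set" and E :: "nat \<Rightarrow> nat \<Rightarrow> bool"
  defines "V \<equiv> {0, 1, 2}" and "E \<equiv> \<lambda>x y. x \<in> V \<and> y \<in> V \<and> x \<noteq> y"
  assumes "even l"
  shows "connected_graph V E \<and> card V \<ge> 3 \<and> largest_nbhd_eigenvalue V E l = 1 - 1 / 2 ^ l"
proof -
  have card: "3 \<le> card V" by (simp add: V_def)
  have "E\<^sup>*\<^sup>* x y" if "x \<in> V" "y \<in> V" for x y
    using that by (cases "x = y") (auto simp: E_def)
  then have conn: "connected_graph V E"
    unfolding connected_graph_def simple_graph_def by (auto simp: V_def E_def)
  interpret big_graph V E by (rule big_graph.intro[OF conn card])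
  have nb: "nb 0 = {1, 2}" "nb (Suc 0) = {0, 2}" "nb 2 = {0, 1}"
    unfolding nb_def by (auto simp: E_def V_def)
  have sum_V: "(\<Sum>v\<in>V. h v) = h 0 + h 1 + h 2" for h :: "nat \<Rightarrow> real"
    by (simp add: V_def)
  have "1 / 4 * ip g g \<le> ip (P g) (P g)" for g
  proof -
    \<comment> \<open>On the triangle \<open>P\<close> has eigenvalues \<open>1\<close>,
      \<open>- 1 / 2\<close>, \<open>- 1 / 2\<close>, so the difference only sees the constant part
      of \<open>g\<close>.\<close>
    have "ip (P g) (P g) - 1 / 4 * ip g g = (g 0 + g 1 + g 2)\<^sup>2 / 2"
      unfolding ip_P_P unfolding ip_def
      by (simp add: sum_V nb power2_eq_square field_simps)
    moreover have "0 \<le> (g 0 + g 1 + g 2)\<^sup>2 / 2" by simp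
    ultimately show ?thesis by linarith
  qed
  moreover obtain k where k: "l = 2 * k" using assms(3) by (rule evenE)
  ultimately have "largest_nbhd_eigenvalue V E l \<le> 1 - (1 / 4) ^ k"
    using nbhd_eigenvalue_le[of k _ "1 / 4"] largest_nbhd_eigenvalue_is[of l] by simp
  also have "(1 / 4 :: real) ^ k = 1 / 2 ^ l" by (simp add: k power_mult power_one_over)
  finally show ?thesis using conn card largest_nbhd_eigenvalue_lower[of l] by simp
qed

lemma path_largest_nbhd_eigenvalue:
  fixes V :: "nat set" and E :: "nat \<Rightarrow> nat \<Rightarrow> bool"
  defines "V \<equiv> {0, 1, 2}" and "E \<equiv> \<lambda>x y. x \<in> V \<and> y \<in> V \<and> x \<noteq> y \<and> (x = 1 \<or> y = 1)"
  assumes "even l" "1 \<le> l"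
  shows "connected_graph V E \<and> card V \<ge> 3 \<and> largest_nbhd_eigenvalue V E l = 1"
proof -
  have card: "3 \<le> card V" by (simp add: V_def)
  have "E\<^sup>*\<^sup>* x 1" "E\<^sup>*\<^sup>* 1 x" if "x \<in> V" for x
    using that by (cases "x = 1"; auto simp: E_def V_def)+
  then have "E\<^sup>*\<^sup>* x y" if "x \<in> V" "y \<in> V" for x y
    using that by (meson rtranclp_trans)
  then have conn: "connected_graph V E"
    unfolding connected_graph_def simple_graph_def by (auto simp: V_def E_def)
  interpret big_graph V E by (rule big_graph.intro[OF conn card])
  have nb: "nb 0 = {1}" "nb (Suc 0) = {0, 2}" "nb 2 = {1}"
    unfolding nb_def by (auto simp: E_def V_def)
  \<comment> \<open>The odd function on the path lies in the kernel of \<open>P\<close>: the ends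
    cancel at the middle vertex, where \<open>f\<close> is zero.\<close>
  define f :: "nat \<Rightarrow> real" where "f v = (if v = 0 then 1 else if v = 2 then -1 else 0)" for v
  have "P f v = 0" for v
  proof (cases "v \<in> V")
    case True
    then have "v = 0 \<or> v = Suc 0 \<or> v = 2" by (auto simp: V_def)
    then show ?thesis by (auto simp: P_def nb f_def)
  qed (rule P_outside)
  then have "P f = (\<lambda>v. 0 * f v)" by auto
  then have "(P ^^ l) f = (\<lambda>v. 0 ^ l * f v)" by (rule P_pow_eigen)
  then have "is_nbhd_eigenvalue V E l 1"
    unfolding is_nbhd_eigenvalue_iff using assms(4)
    by (intro exI[of _ f]) (auto simp: f_def V_def)
  then have "1 \<le> largest_nbhd_eigenvalue V E l" by (rule largest_nbhd_eigenvalue_ge)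
  then show ?thesis using conn card largest_nbhd_eigenvalue_upper[OF assms(3,4)] by simp
qed

theorem mainTheorem6:
  shows "(\<forall>(V::'a set) E (l::nat). connected_graph V E \<and> card V \<ge> 3 \<and> l \<ge> 1 \<longrightarrow>
            (\<exists>\<mu>. is_nbhd_eigenvalue V E l \<mu> \<and> \<bar>1 - \<mu>\<bar> \<le> 1 / 2 ^ l))
       \<and> (\<forall>(V::'a set) E (l::nat). connected_graph V E \<and> card V \<ge> 3 \<and> l \<ge> 1 \<and> even l \<longrightarrow>
            1 - 1 / 2 ^ l \<le> largest_nbhd_eigenvalue V E l \<and> largest_nbhd_eigenvalue V E l \<le> 1)
       \<and> (\<forall>l::nat. l \<ge> 1 \<and> even l \<longrightarrow>
            (\<exists>(V::nat set) E. connected_graph V E \<and> card V \<ge> 3 \<and>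
                 largest_nbhd_eigenvalue V E l = 1 - 1 / 2 ^ l) \<and>
            (\<exists>(V::nat set) E. connected_graph V E \<and> card V \<ge> 3 \<and>
                 largest_nbhd_eigenvalue V E l = 1))"
proof (intro conjI allI impI; (elim conjE)?)
  fix V :: "'a set" and E :: "'a \<Rightarrow> 'a \<Rightarrow> bool" and l :: nat
  assume "connected_graph V E" "3 \<le> card V"
  then interpret big_graph V E by (rule big_graph.intro)
  show "\<exists>\<mu>. is_nbhd_eigenvalue V E l \<mu> \<and> \<bar>1 - \<mu>\<bar> \<le> 1 / 2 ^ l"
    by (rule nbhd_eigenvalue_near_1)
  show "1 - 1 / 2 ^ l \<le> largest_nbhd_eigenvalue V E l"
    by (rule largest_nbhd_eigenvalue_lower)
  show "largest_nbhd_eigenvalue V E l \<le> 1" if "even l" "1 \<le> l"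
    using that by (rule largest_nbhd_eigenvalue_upper)
next
  fix l :: nat
  assume l: "1 \<le> l" "even l"
  show "\<exists>(V::nat set) E. connected_graph V E \<and> card V \<ge> 3 \<and>
      largest_nbhd_eigenvalue V E l = 1 - 1 / 2 ^ l"
    using triangle_largest_nbhd_eigenvalue[OF l(2)] by (intro exI)
  show "\<exists>(V::nat set) E. connected_graph V E \<and> card V \<ge> 3 \<and> largest_nbhd_eigenvalue V E l = 1"
    using path_largest_nbhd_eigenvalue[OF l(2,1)] by (intro exI)
qed

end
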